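(* Let $A$ be a non-unital algebra over a field $\mathbb{F}$ and let $(\tilde{A},\cdot,(0,1)^T)$ be its unitalization. The following statements hold: 1) $Z(\tilde{A})\cong Z(A)\oplus\mathbb{F}$. 2) $N(\tilde{A})\cong N(A)\oplus\mathbb{F}$. 3) $$AC(\tilde{A})=\left\{\begin{pmatrix} b\\ \mu\end{pmatrix}\in\tilde{A}\ \middle|\ b\in Z(A)\cap N(A),\ [A,A,A]_{\mathrm{as}}\subseteq Eig_{-\mu}(L_b)\right\}$$ is a subalgebra of $(\tilde{A},\cdot,(0,1)^T)$. Moreover, $\begin{pmatrix} a\\ 0\end{pmatrix}\in AC(\tilde{A})$ if and only if $a\in HU_n(A)$.
   Context: An algebra $A$ over $\mathbb{F}$ is a linear space with a bilinear product, written by juxtaposition (not assumed associative or commutative); non-unital means it is not equipped with a left, right or two-sided unity. The unitalization is the linear space $\tilde{A}=A\oplus\mathbb{F}$ with product $$\begin{pmatrix} a_1\\ \lambda_1\end{pmatrix}\cdot\begin{pmatrix} a_2\\ \lambda_2\end{pmatrix}=\begin{pmatrix} a_1a_2+\lambda_1a_2+\lambda_2a_1\\ \lambda_1\lambda_2\end{pmatrix},$$ a two-sided unital algebra with unity $(0,1)^T$. For any algebra $B$: $[x,y,z]_{\mathrm{as}}=(xy)z-x(yz)$; $[B,B,B]_{\mathrm{as}}$ is the set of all associators; $Z(B)=\{a\mid ax=xa\ \forall x\in B\}$; $N(B)=\{a\mid [a,x,y]_{\mathrm{as}}=[x,a,y]_{\mathrm{as}}=[x,y,a]_{\mathrm{as}}=0\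 \forall x,y\in B\}$; $Ann_B^l(S)=\{a\in B\mid as=0\ \forall s\in S\}$; $AC(B)=\{a\in Z(B)\mid Ba\subseteq N(B)\text{ and } Ba \text{ is a two-sided ideal}\}$, which for two-sided unital $B$ (such as $\tilde A$) equals $Z(B)\cap N(B)\cap Ann_B^l([B,B,B]_{\mathrm{as}})$; $HU_n(B)=Z(B)\cap N(B)\cap Ann_B^l([B,B,B]_{\mathrm{as}})$. $L_b\colon x\mapsto bx$ on $A$, and $Eig_{-\mu}(L_b)=\{x\in A\mid bx=-\mu x\}$. In 1) and 2), $Z(A)\oplus\mathbb{F}$ and $N(A)\oplus\mathbb{F}$ are the corresponding subspaces of $A\oplus\mathbb{F}=\tilde{A}$. *)

theory Defs
  imports "HOL-Analysis.Product_Vector"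
begin

text \<open>
  Algebras over a field, neither associative nor commutative nor unital in general.
  The carrier is the whole type; \<^term>\<open>sc\<close> is the scalar action and \<^term>\<open>mult\<close> the product.
\<close>

locale nonassoc_algebra = vector_space sc
  for sc :: "'f::field \<Rightarrow> 'a::ab_group_add \<Rightarrow> 'a" +
  fixes mult :: "'a \<Rightarrow> 'a \<Rightarrow> 'a"
  assumes linear_mult_right: "Vector_Spaces.linear sc sc (\<lambda>y. mult x y)"
    and linear_mult_left: "Vector_Spaces.linear sc sc (\<lambda>x. mult x y)"

definition associator :: "('a::ab_group_add \<Rightarrow> 'a \<Rightarrow> 'a) \<Rightarrow> 'a \<Rightarrow> 'a \<Rightarrow> 'a \<Rightarrow> 'a" where
  "associator mult x y z = mult (mult x y) z - mult x (mult y z)"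

text \<open>The set of all associators, not its linear span.\<close>

definition associators :: "('a::ab_group_add \<Rightarrow> 'a \<Rightarrow> 'a) \<Rightarrow> 'a set" where
  "associators mult = {associator mult x y z | x y z. True}"

text \<open>Commutation only: elements of the center need not associate with the others.\<close>

definition center :: "('a \<Rightarrow> 'a \<Rightarrow> 'a) \<Rightarrow> 'a set" where
  "center mult = {a. \<forall>x. mult a x = mult x a}"

definition nucleus :: "('a::ab_group_add \<Rightarrow> 'a \<Rightarrow> 'a) \<Rightarrow> 'a set" where
  "nucleus mult = {a. \<forall>x y. associator mult a x y = 0 \<and> associator mult x a y = 0
                          \<and> associator mult x y a = 0}"

definition left_annihilator :: "('a::zero \<Rightarrow> 'a \<Rightarrow> 'a) \<Rightarrow> 'a set \<Rightarrow> 'a set" where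
  "left_annihilator mult S = {a. \<forall>s\<in>S. mult a s = 0}"

definition two_sided_ideal ::
    "('f::field \<Rightarrow> 'a::ab_group_add \<Rightarrow> 'a) \<Rightarrow> ('a \<Rightarrow> 'a \<Rightarrow> 'a) \<Rightarrow> 'a set \<Rightarrow> bool" where
  "two_sided_ideal sc mult I \<longleftrightarrow>
     module.subspace sc I \<and> (\<forall>x. \<forall>i\<in>I. mult x i \<in> I \<and> mult i x \<in> I)"

definition subalgebra ::
    "('f::field \<Rightarrow> 'a::ab_group_add \<Rightarrow> 'a) \<Rightarrow> ('a \<Rightarrow> 'a \<Rightarrow> 'a) \<Rightarrow> 'a set \<Rightarrow> bool" where
  "subalgebra sc mult S \<longleftrightarrow>
     module.subspace sc S \<and> (\<forall>x\<in>S. \<forall>y\<in>S. mult x y \<in> S)"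

definition AC :: "('f::field \<Rightarrow> 'a::ab_group_add \<Rightarrow> 'a) \<Rightarrow> ('a \<Rightarrow> 'a \<Rightarrow> 'a) \<Rightarrow> 'a set" where
  "AC sc mult = {a \<in> center mult. range (\<lambda>b. mult b a) \<subseteq> nucleus mult
                       \<and> two_sided_ideal sc mult (range (\<lambda>b. mult b a))}"

definition HU\<^sub>n :: "('a::ab_group_add \<Rightarrow> 'a \<Rightarrow> 'a) \<Rightarrow> 'a set" where
  "HU\<^sub>n mult = center mult \<inter> nucleus mult \<inter> left_annihilator mult (associators mult)"

definition Eig :: "('f \<Rightarrow> 'a \<Rightarrow> 'a) \<Rightarrow> 'f \<Rightarrow> ('a \<Rightarrow> 'a) \<Rightarrow> 'a set" where
  "Eig sc c f = {x. f x = sc c x}"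

text \<open>The unitalization lives on the product of the algebra with its field of scalars.\<close>

abbreviation unit_scale ::
    "('f::field \<Rightarrow> 'a::ab_group_add \<Rightarrow> 'a) \<Rightarrow> 'f \<Rightarrow> 'a \<times> 'f \<Rightarrow> 'a \<times> 'f" where
  "unit_scale sc \<equiv> module_prod.scale sc (*)"

fun unit_mult :: "('f::field \<Rightarrow> 'a::ab_group_add \<Rightarrow> 'a) \<Rightarrow> ('a \<Rightarrow> 'a \<Rightarrow> 'a)
    \<Rightarrow> 'a \<times> 'f \<Rightarrow> 'a \<times> 'f \<Rightarrow> 'a \<times> 'f" where
  "unit_mult sc mult (a1, l1) (a2, l2) =
     (mult a1 a2 + sc l1 a2 + sc l2 a1, l1 * l2)"

context nonassoc_algebra
begin

lemma mult_simps:
  "mult (x + y) z = mult x z + mult y z" "mult x (y + z) = mult x y + mult x z"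
  "mult (sc c x) y = sc c (mult x y)" "mult x (sc c y) = sc c (mult x y)"
  "mult 0 x = 0" "mult x 0 = 0"
proof -
  interpret R: Vector_Spaces.linear sc sc "\<lambda>y. mult x y" for x by (rule linear_mult_right)
  interpret L: Vector_Spaces.linear sc sc "\<lambda>x. mult x y" for y by (rule linear_mult_left)
  show "mult (x + y) z = mult x z + mult y z" "mult x (y + z) = mult x y + mult x z"
    "mult (sc c x) y = sc c (mult x y)" "mult x (sc c y) = sc c (mult x y)"
    "mult 0 x = 0" "mult x 0 = 0"
    by (rule L.add R.add L.scale R.scale L.zero R.zero)+
qed

lemma vector_space_prod_scale: "vector_space_prod sc ((*) :: 'f \<Rightarrow> 'f \<Rightarrow> 'f)"
  by unfold_locales (auto simp: algebra_simps)

lemma unit_scale_Pair: "unit_scale sc c (a, l) = (sc c a, c * l)"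
proof -
  interpret P: vector_space_prod sc "(*) :: 'f \<Rightarrow> 'f \<Rightarrow> 'f"
    by (rule vector_space_prod_scale)
  show ?thesis by (rule P.scale_prod)
qed

lemma unit_mult_simps:
  "unit_mult sc mult (x + y) z = unit_mult sc mult x z + unit_mult sc mult y z"
  "unit_mult sc mult x (y + z) = unit_mult sc mult x y + unit_mult sc mult x z"
  "unit_mult sc mult (unit_scale sc c x) y = unit_scale sc c (unit_mult sc mult x y)"
  "unit_mult sc mult x (unit_scale sc c y) = unit_scale sc c (unit_mult sc mult x y)"
  by (cases x; cases y; cases z; simp add: unit_scale_Pair mult_simps scale_left_distrib
      scale_right_distrib distrib_left distrib_right mult_ac)+

lemma nonassoc_algebra_unitalization:
  "nonassoc_algebra (unit_scale sc) (unit_mult sc mult)"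
proof -
  interpret P: vector_space_prod sc "(*) :: 'f \<Rightarrow> 'f \<Rightarrow> 'f"
    by (rule vector_space_prod_scale)
  show ?thesis
    by unfold_locales (rule unit_mult_simps)+
qed

lemma unit_mult_unity:
  "unit_mult sc mult (0, 1) x = x" "unit_mult sc mult x (0, 1) = x"
  by (cases x, simp add: mult_simps)+

lemma subspace_center: "subspace (center mult)"
  by (auto simp: subspace_def center_def mult_simps)

lemma subspace_nucleus: "subspace (nucleus mult)"
proof (rule subspaceI)
  show "0 \<in> nucleus mult"
    by (simp add: nucleus_def associator_def mult_simps)
next
  fix a b assume "a \<in> nucleus mult" "b \<in> nucleus mult"
  then show "a + b \<in> nucleus mult"
    by (simp add: nucleus_def associator_def mult_simps)
next
  fix c a assume "a \<in> nucleus mult"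
  then show "sc c a \<in> nucleus mult"
    by (simp add: nucleus_def associator_def mult_simps)
qed

end

end

theory Submission
  imports Defs
begin

text \<open>
  The unity of the unitalization \<open>U\<close> of an algebra \<open>A\<close> associates and commutes with everything, so
  an associator of elements of \<open>U\<close> only sees their components in \<open>A\<close> (\<open>associator_unit_mult\<close>),
  and similarly for commutators. This settles the center and the nucleus.

  The rest is a fact about any algebra \<open>B\<close>: a central and nuclear element can be moved freely out of
  each slot of an associator, \<open>[ax,y,z] = [x,ay,z] = [x,y,az] = a[x,y,z]\<close>. Hence such an \<open>a\<close> satisfies
  \<open>Ba \<subseteq> N(B)\<close> exactly when it annihilates all associators. The set \<open>Ba\<close> is then automatically an
  ideal, and if \<open>B\<close> has a unity then \<open>Ba\<close> contains \<open>a\<close>, so that \<open>Ba \<subseteq> N(B)\<close> already makes \<open>a\<close>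
  nuclear. For such \<open>B\<close>, therefore, \<open>AC(B)\<close> is the set of central nuclear elements annihilating all associators,
  \<open>HU\<^sub>n(B)\<close> (\<open>AC_eq_HUn\<close>), and in any algebra this set is a subalgebra, again because \<open>a\<close> moves out of
  associators (\<open>subalgebra_HUn\<close>).

  Applied to \<open>U\<close>, whose associators are the elements \<open>(s, 0)\<close> with \<open>s\<close> an associator of \<open>A\<close>, the
  annihilation condition on \<open>(b, \<mu>)\<close> reads \<open>b s + \<mu> s = 0\<close>: every associator lies in
  the eigenspace of left multiplication by \<open>b\<close> for the eigenvalue \<open>-\<mu>\<close>.
\<close>

lemma center_commute: "a \<in> center mult \<Longrightarrow> mult a x = mult x a"
  by (simp add: center_def)

lemma nucleus_assoc:
  assumes "a \<in> nucleus mult"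
  shows "mult (mult a x) y = mult a (mult x y)" "mult (mult x a) y = mult x (mult a y)"
    "mult (mult x y) a = mult x (mult y a)"
  using assms by (auto simp: nucleus_def associator_def)

context nonassoc_algebra
begin

lemma mult_diff_right: "mult x (y - z) = mult x y - mult x z"
  by (metis mult_simps(2) add_diff_cancel diff_add_cancel)

lemma associator_extract:
  assumes "a \<in> center mult" and "a \<in> nucleus mult"
  shows "associator mult (mult a x) y z = mult a (associator mult x y z)"
    and "associator mult x (mult a y) z = mult a (associator mult x y z)"
    and "associator mult x y (mult a z) = mult a (associator mult x y z)"
proof -
  note nuc = nucleus_assoc[OF assms(2)]
  have out: "mult u (mult a v) = mult a (mult u v)" for u v
    using center_commute[OF assms(1)] nuc(1,2) by metis
  show "associator mult (mult a x) y z = mult a (associator mult x y z)"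
    "associator mult x (mult a y) z = mult a (associator mult x y z)"
    "associator mult x y (mult a z) = mult a (associator mult x y z)"
    by (simp_all add: associator_def mult_diff_right nuc(1) out)
qed

text \<open>This is where annihilation of associators enters: it is what \<open>Ba \<subseteq> N(B)\<close> means once \<open>a\<close>
  can be moved out of associators.\<close>

lemma multiples_in_nucleus_iff:
  assumes "a \<in> center mult" and "a \<in> nucleus mult"
  shows "range (\<lambda>b. mult b a) \<subseteq> nucleus mult
         \<longleftrightarrow> a \<in> left_annihilator mult (associators mult)"
proof -
  have "mult b a \<in> nucleus mult \<longleftrightarrow>
      (\<forall>x y. mult a (associator mult b x y) = 0 \<and> mult a (associator mult x b y) = 0
           \<and> mult a (associator mult x y b) = 0)" for b
    by (simp add: nucleus_def associator_extract[OF assms]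
        flip: center_commute[OF assms(1)])
  then show ?thesis
    unfolding left_annihilator_def associators_def image_subset_iff by blast
qed

lemma two_sided_ideal_multiples:
  assumes "a \<in> center mult" and "a \<in> nucleus mult"
  shows "two_sided_ideal sc mult (range (\<lambda>b. mult b a))"
proof -
  interpret L: Vector_Spaces.linear sc sc "\<lambda>b. mult b a"
    by (rule linear_mult_left)
  have "mult x (mult b a) = mult (mult x b) a" "mult (mult b a) x = mult (mult b x) a" for x b
    using nucleus_assoc[OF assms(2)] center_commute[OF assms(1)] by metis+
  then show ?thesis
    using L.subspace_image[OF subspace_UNIV] by (auto simp: two_sided_ideal_def)
qed

text \<open>The unity enters through \<open>a = 1 a \<in> Ba\<close>, which makes \<open>a\<close> itself nuclear.\<close>

lemma AC_eq_HUn: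
  assumes unity: "\<And>x. mult e x = x"
  shows "AC sc mult = HU\<^sub>n mult"
proof -
  have "a \<in> nucleus mult" if "range (\<lambda>b. mult b a) \<subseteq> nucleus mult" for a
    using that unity by (metis rangeI subsetD)
  then show ?thesis
    using multiples_in_nucleus_iff two_sided_ideal_multiples
    unfolding AC_def HU\<^sub>n_def by blast
qed

lemma subalgebra_HUn: "subalgebra sc mult (HU\<^sub>n mult)"
proof -
  have "subspace (left_annihilator mult S)" for S
    by (auto simp: subspace_def left_annihilator_def mult_simps)
  then have "subspace (HU\<^sub>n mult)"
    unfolding HU\<^sub>n_def by (intro subspace_inter subspace_center subspace_nucleus)
  moreover have "mult a b \<in> HU\<^sub>n mult" if "a \<in> HU\<^sub>n mult" "b \<in> HU\<^sub>n mult" for a b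
  proof -
    have a: "a \<in> center mult" "a \<in> nucleus mult"
      and b: "b \<in> center mult" "b \<in> nucleus mult"
        "b \<in> left_annihilator mult (associators mult)"
      using that by (auto simp: HU\<^sub>n_def)
    have "mult (mult a b) x = mult x (mult a b)" for x
      using nucleus_assoc[OF a(2)] center_commute[OF a(1)] center_commute[OF b(1)] by metis
    moreover have "mult a b \<in> nucleus mult"
      using b(2) by (simp add: nucleus_def associator_extract[OF a] mult_simps)
    moreover have "mult (mult a b) s = 0" if "s \<in> associators mult" for s
      using b(3) that by (simp add: left_annihilator_def nucleus_assoc(1)[OF a(2)] mult_simps)
    ultimately show ?thesis
      by (simp add: HU\<^sub>n_def center_def left_annihilator_def)
  qed
  ultimately show ?thesis
    by (simp add: subalgebra_def)
qed

lemma associator_unit_mult: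
  "associator (unit_mult sc mult) (a, \<alpha>) (b, \<beta>) (c, \<gamma>) = (associator mult a b c, 0)"
  by (simp add: associator_def mult_simps scale_right_distrib algebra_simps)

lemma associators_unit_mult:
  "associators (unit_mult sc mult) = associators mult \<times> {0}"
  by (auto simp: associators_def associator_unit_mult)

lemma center_unit_mult: "center (unit_mult sc mult) = center mult \<times> UNIV"
  by (auto simp: center_def algebra_simps)

lemma nucleus_unit_mult: "nucleus (unit_mult sc mult) = nucleus mult \<times> UNIV"
  by (auto simp: nucleus_def associator_unit_mult zero_prod_def)

lemma left_annihilator_associators_unit_mult:
  "(b, \<mu>) \<in> left_annihilator (unit_mult sc mult) (associators (unit_mult sc mult))
   \<longleftrightarrow> associators mult \<subseteq> Eig sc (- \<mu>) (mult b)"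
  by (auto simp: left_annihilator_def associators_unit_mult Eig_def zero_prod_def
      eq_neg_iff_add_eq_0)

lemma HUn_unit_mult:
  "HU\<^sub>n (unit_mult sc mult) =
     {(b, \<mu>). b \<in> center mult \<inter> nucleus mult \<and> associators mult \<subseteq> Eig sc (- \<mu>) (mult b)}"
  by (auto simp: HU\<^sub>n_def center_unit_mult nucleus_unit_mult
      left_annihilator_associators_unit_mult)

lemma mem_HUn_unit_mult_zero: "(a, 0) \<in> HU\<^sub>n (unit_mult sc mult) \<longleftrightarrow> a \<in> HU\<^sub>n mult"
  unfolding HUn_unit_mult by (auto simp: HU\<^sub>n_def left_annihilator_def Eig_def)

end

theorem proposition65:
  fixes sc :: "'f::field \<Rightarrow> 'a::ab_group_add \<Rightarrow> 'a"
    and mult :: "'a \<Rightarrow> 'a \<Rightarrow> 'a"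
  assumes "nonassoc_algebra sc mult"
  shows "center (unit_mult sc mult) = center mult \<times> (UNIV :: 'f set) \<and>
         nucleus (unit_mult sc mult) = nucleus mult \<times> (UNIV :: 'f set) \<and>
         AC (unit_scale sc) (unit_mult sc mult) =
           {(b, \<mu>). b \<in> center mult \<inter> nucleus mult
                   \<and> associators mult \<subseteq> Eig sc (- \<mu>) (mult b)} \<and>
         subalgebra (unit_scale sc) (unit_mult sc mult)
           (AC (unit_scale sc) (unit_mult sc mult)) \<and>
         (\<forall>a. (a, 0) \<in> AC (unit_scale sc) (unit_mult sc mult) \<longleftrightarrow> a \<in> HU\<^sub>n mult)"
proof -
  interpret A: nonassoc_algebra sc mult
    by (rule assms)
  interpret U: nonassoc_algebra "unit_scale sc" "unit_mult sc mult"
    by (rule A.nonassoc_algebra_unitalization)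
  have AC: "AC (unit_scale sc) (unit_mult sc mult) = HU\<^sub>n (unit_mult sc mult)"
    by (rule U.AC_eq_HUn[OF A.unit_mult_unity(1)])
  show ?thesis
    unfolding AC
    by (intro conjI allI A.center_unit_mult A.nucleus_unit_mult A.HUn_unit_mult
        U.subalgebra_HUn A.mem_HUn_unit_mult_zero)
qed

end
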